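(* Let $n\in\{2,3\}$ and let the $n$-dimensional positioning error vector $\mathbf{e}_{n\mathrm{D}}\in\mathbb{R}^n$ follow a Gaussian mixture distribution with probability density function $$p(\mathbf{e})=\sum_{l=1}^{L} w^{(l)}\, f(\mathbf{e};\mathbf{m}^{(l)},\mathsf{\Sigma}^{(l)}),\qquad \mathbf e\in\mathbb{R}^n,$$ where the weights $w^{(l)}>0$ satisfy $\sum_{l=1}^L w^{(l)}=1$, $\mathbf{m}^{(l)}\in\mathbb{R}^n$, $\mathsf{\Sigma}^{(l)}\in\mathbb{R}^{n\times n}$ is symmetric positive definite, and $f(\cdot;\mathbf{m},\mathsf{\Sigma})$ is the density of $\mathcal{N}(\mathbf{m},\mathsf{\Sigma})$. Then the problem of computing the protection level $$\mathrm{PL}_{n\mathrm{D}}(P_{\mathrm{TIR}})=\min\{r \mid \Pr\{\Vert\mathbf{e}_{n\mathrm{D}}\Vert>r\}<P_{\mathrm{TIR}}\}$$ can be reformulated as $$\mathrm{PL}_{n\mathrm{D}}=\min\Big\{r\ \Big|\ \sum_{l=1}^{L}w^{(l)}\big[1-F_{Z_l}(r^2)\big]<P_{\mathrm{TIR}}\Big\},$$ where, for $l=1,\dots,L$, $F_{Z_l}(z)=\Pr\{Z_l\le z\}$ is the cumulative distribution function of a random variable $Z_l$ given by a weighted sum of $n$ independent noncentral chi-square distributed random variables $W_{l,1},\dots,W_{l,n}$, each with one degree of freedom and noncentrality parameter $\nu_{l,i}^2$: $$Z_l=\sum_{i=1}^n\omega_{l,i}W_{l,i},\qquad W_{l,i}\sim\chi^2(1,\nu_{l,i}^2),\quad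 i=1,\dots,n.$$ Here $\{\omega_{l,i}\}$ and $\{\nu_{l,i}^2\}$ are determined by $\mathsf{\Sigma}^{(l)}$ and $\mathbf{m}^{(l)}$ as follows: take an eigendecomposition $\mathsf{\Sigma}^{(l)}=\mathsf{P}_l\mathsf{\Omega}_l\mathsf{P}_l^{\mathrm T}$ with $\mathsf{P}_l\in\mathbb{R}^{n\times n}$ orthogonal and $\mathsf{\Omega}_l$ diagonal; the diagonal elements of $\mathsf{\Omega}_l$ are $\omega_{l,1},\dots,\omega_{l,n}$ (since $\mathsf{\Sigma}^{(l)}$ is positive definite, $\omega_{l,i}>0$ for all $i$); and $$(\nu_{l,1},\dots,\nu_{l,n})^{\mathrm T}=\mathsf{P}_l^{\mathrm T}[\mathsf{\Sigma}^{(l)}]^{-1/2}\mathbf{m}^{(l)} .$$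
   Context: $\Vert\cdot\Vert$ is the Euclidean norm, and $r$ is a distance (radius). $\mathsf{\Sigma}^{-1/2}$ denotes the inverse of the symmetric positive definite square root of $\mathsf{\Sigma}$. $\chi^2(1,\nu^2)$ denotes the noncentral chi-square distribution with one degree of freedom and noncentrality parameter $\nu^2$, i.e. the law of $(G+\nu)^2$ with $G$ a standard normal variable. $P_{\mathrm{TIR}}$ is the target integrity risk, a prescribed probability. The error vector $\mathbf{e}_{n\mathrm{D}}$ is the difference between the true and the estimated position for $n=3$, or its coordinates with respect to two orthonormal vectors spanning a 2D subspace for $n=2$; the protection level is the minimum distance $r$ such that the integrity risk $\Pr\{\Vert\mathbf{e}_{n\mathrm{D}}\Vert>r\}$ does not exceed the target, i.e. the radius of the smallest origin-centred disc ($n=2$) or ball ($n=3$) containing $\mathbf{e}_{n\mathrm{D}}$ with the required probability.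
   Formalization: With the strict inequality the minimum is never attained (the set of feasible distances r ≥ 0 is open on the left, or empty if the target is 0), so "min" is read as the infimum; in addition the feasible sets of the two problems are shown to be equal. *)

theory Defs
  imports "HOL-Probability.Probability"
begin

definition sym_pos_def :: "real ^ 'n ^ 'n \<Rightarrow> bool" where
  "sym_pos_def A \<longleftrightarrow> transpose A = A \<and> (\<forall>x. x \<noteq> 0 \<longrightarrow> x \<bullet> (A *v x) > 0)"

text \<open>The description below is proper only for symmetric positive definite \<open>A\<close>: exactly then is there
  such a root \<open>R\<close>, and it is unique.\<close>

definition spd_sqrt :: "real ^ 'n ^ 'n \<Rightarrow> real ^ 'n ^ 'n" where
  "spd_sqrt A = (THE R. sym_pos_def R \<and> R ** R = A)"

definition mvn_density :: "real ^ 'n \<Rightarrow> real ^ 'n ^ 'n \<Rightarrow> real ^ 'n \<Rightarrow> real" where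
  "mvn_density m \<Sigma> x =
     exp (- ((x - m) \<bullet> (matrix_inv \<Sigma> *v (x - m))) / 2) / sqrt ((2 * pi) ^ CARD('n) * det \<Sigma>)"

definition gaussian_mixture_density ::
  "nat \<Rightarrow> (nat \<Rightarrow> real) \<Rightarrow> (nat \<Rightarrow> real ^ 'n) \<Rightarrow> (nat \<Rightarrow> real ^ 'n ^ 'n) \<Rightarrow> real ^ 'n \<Rightarrow> real" where
  "gaussian_mixture_density L w m \<Sigma> x = (\<Sum>l = 1..L. w l * mvn_density (m l) (\<Sigma> l) x)"

text \<open>One degree of freedom; the argument is the noncentrality parameter itself, so that
  \<open>noncentral_chi_square_1 (\<nu>\<^sup>2)\<close> is the law of \<open>(G + \<bar>\<nu>\<bar>)\<^sup>2\<close>, which by symmetry of the standard normal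
  variable \<open>G\<close> is that of \<open>(G + \<nu>)\<^sup>2\<close>.\<close>

definition noncentral_chi_square_1 :: "real \<Rightarrow> real measure" where
  "noncentral_chi_square_1 \<delta> = distr std_normal_distribution borel (\<lambda>g. (g + sqrt \<delta>)\<^sup>2)"

text \<open>The radius \<open>r\<close> is a distance, hence nonnegative. For an error with a continuous law the strict
  inequality makes the feasible set relatively open, so that its minimum has to be read as its infimum.
  The set is empty if \<open>P = 0\<close> and the error is unbounded; \<open>Inf\<close> is then unspecified.\<close>

definition feasible_radii :: "'a measure \<Rightarrow> ('a \<Rightarrow> 'v::real_normed_vector) \<Rightarrow> real \<Rightarrow> real set" where
  "feasible_radii M e P = {r. 0 \<le> r \<and> \<P>(x in M. norm (e x) > r) < P}"

definition protection_level :: "'a measure \<Rightarrow> ('a \<Rightarrow> 'v::real_normed_vector) \<Rightarrow> real \<Rightarrow> real" where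
  "protection_level M e P = Inf (feasible_radii M e P)"

end

theory Submission
  imports Defs
begin

text \<open>Substituting \<open>x = Q \<Omega>\<^sup>1\<^sup>/\<^sup>2 g + m\<close> with \<open>\<Sigma> = Q \<Omega> Q\<^sup>T\<close> turns the density of one mixture component
  into that of a standard normal vector \<open>g\<close>. Since \<open>\<nu> = \<Omega>\<^sup>-\<^sup>1\<^sup>/\<^sup>2 Q\<^sup>T m\<close>, we have
  \<open>x = Q \<Omega>\<^sup>1\<^sup>/\<^sup>2 (g + \<nu>)\<close>, and as \<open>Q\<close> preserves norms the squared norm of \<open>x\<close> is
  \<open>\<Sum>i. \<omega> i * (g i + \<nu> i)\<^sup>2\<close>, which has the law of \<open>Z\<close>. Hence each component contributes
  \<open>1 - F\<^sub>Z (r\<^sup>2)\<close> to the integrity risk, and the two feasible sets of radii agree.\<close>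

section \<open>Rotation invariance of Lebesgue measure\<close>

text \<open>By surjectivity \<open>a = f b\<close>, and linearity turns the shift by
  \<open>a\<close> after \<open>f\<close> into the shift by \<open>b\<close> before
  \<open>f\<close>, which Lebesgue measure absorbs.\<close>

lemma distr_translation_lborel_orthogonal:
  fixes f :: "'a::euclidean_space \<Rightarrow> 'a"
  assumes f: "orthogonal_transformation f"
  shows "distr (distr lborel borel f) borel ((+) a) = distr lborel borel f"
proof -
  have lin: "linear f" and surj: "surj f"
    using f by (simp_all add: orthogonal_transformation_linear orthogonal_transformation_surj)
  have [measurable]: "f \<in> borel \<rightarrow>\<^sub>M borel"
    using lin by (intro borel_measurable_continuous_onI linear_continuous_on linear_conv_bounded_linear[THEN iffD1])
  obtain b where b: "a = f b" using surj by (metis surjD)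
  have "distr (distr lborel borel f) borel ((+) a) = distr lborel borel (\<lambda>x. f (b + x))"
    by (subst distr_distr) (auto simp: b comp_def linear_add[OF lin])
  also have "\<dots> = distr (distr lborel borel ((+) b)) borel f"
    by (subst distr_distr) (auto simp: comp_def)
  also have "\<dots> = distr lborel borel f"
    by (simp add: lborel_distr_plus)
  finally show ?thesis .
qed

text \<open>Uniqueness of Haar measure by Weil's double-integral argument. The change of variables theorem
  in the library needs a well-ordered index type, hence does not apply to \<open>real ^ 'n\<close> in general.\<close>

lemma emeasure_translation_invariant_commute:
  fixes \<mu> :: "'a::euclidean_space measure"
  assumes sf: "sigma_finite_measure \<mu>" and sets_\<mu> [measurable_cong, simp]: "sets \<mu> = sets borel"
    and inv: "\<And>a. distr \<mu> borel ((+) a) = \<mu>"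
    and A [measurable]: "A \<in> sets borel" and B [measurable]: "B \<in> sets borel"
  shows "emeasure \<mu> A * emeasure lborel B = emeasure lborel A * emeasure \<mu> (uminus ` B)"
proof -
  interpret \<mu>: sigma_finite_measure \<mu> by (rule sf)
  interpret P: pair_sigma_finite "lborel :: 'a measure" \<mu> by standard
  have neg: "uminus ` B = uminus -` B"
    by (force simp: image_iff)
  have [measurable]: "uminus ` B \<in> sets borel"
    unfolding neg using measurable_sets[OF borel_measurable_uminus[OF measurable_ident] B] by simp
  \<comment> \<open>Translation invariance as a substitution rule, for arbitrary
    \<open>\<nu>\<close> because it is applied both to \<open>\<mu>\<close> and to
    \<open>lborel\<close>.\<close>
  have shift: "(\<integral>\<^sup>+x. h (a + x) \<partial>\<nu>) = (\<integral>\<^sup>+x. h x \<partial>\<nu>)"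
    if "distr \<nu> borel ((+) a) = \<nu>" "sets \<nu> = sets borel" "h \<in> borel_measurable borel"
    for h :: "'a \<Rightarrow> ennreal" and \<nu> :: "'a measure" and a
    using that by (subst (2) that(1)[symmetric], subst nn_integral_distr)
      (auto simp: measurable_cong_sets[OF that(2) refl])
  have "emeasure \<mu> A * emeasure lborel B = (\<integral>\<^sup>+y. emeasure \<mu> A * indicator B y \<partial>lborel)"
    by (simp add: nn_integral_cmult)
  also have "\<dots> = (\<integral>\<^sup>+y. (\<integral>\<^sup>+x. indicator A (y + x) \<partial>\<mu>) * indicator B y \<partial>lborel)"
    by (subst shift[OF inv sets_\<mu>]) auto
  also have "\<dots> = (\<integral>\<^sup>+y. (\<integral>\<^sup>+x. indicator A (y + x) * indicator B y \<partial>\<mu>) \<partial>lborel)"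
    by (intro nn_integral_cong) (simp add: nn_integral_multc)
  also have "\<dots> = (\<integral>\<^sup>+x. (\<integral>\<^sup>+y. indicator A (x + y) * indicator B y \<partial>lborel) \<partial>\<mu>)"
    by (subst P.Fubini') (auto simp: add.commute)
  \<comment> \<open>Translating \<open>y\<close> by \<open>x\<close> moves the dependence on
    \<open>x\<close> from \<open>A\<close> to \<open>B\<close>.\<close>
  also have "\<dots> = (\<integral>\<^sup>+x. (\<integral>\<^sup>+y. indicator A y * indicator B (y - x) \<partial>lborel) \<partial>\<mu>)"
  proof (rule nn_integral_cong)
    fix x :: 'a
    show "(\<integral>\<^sup>+y. indicator A (x + y) * indicator B y \<partial>lborel) =
        (\<integral>\<^sup>+y. indicator A y * indicator B (y - x) \<partial>lborel)"
      using shift[of lborel x "\<lambda>y. indicator A y * indicator B (y - x)"]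
      by (simp add: lborel_distr_plus)
  qed
  \<comment> \<open>\<open>y - x\<close> lies in \<open>B\<close> iff \<open>- y + x\<close> lies in
    the reflection of \<open>B\<close>, so the inner integral is again that of a translate, now for
    \<open>\<mu>\<close>.\<close>
  also have "\<dots> = (\<integral>\<^sup>+y. (\<integral>\<^sup>+x. indicator A y * indicator (uminus ` B) (- y + x) \<partial>\<mu>) \<partial>lborel)"
    by (subst P.Fubini') (auto simp: neg indicator_def)
  also have "\<dots> = (\<integral>\<^sup>+y. indicator A y * (\<integral>\<^sup>+x. indicator (uminus ` B) (- y + x) \<partial>\<mu>) \<partial>lborel)"
    by (intro nn_integral_cong) (simp add: nn_integral_cmult)
  also have "\<dots> = (\<integral>\<^sup>+y. indicator A y * emeasure \<mu> (uminus ` B) \<partial>lborel)"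
    by (subst shift[OF inv sets_\<mu>]) auto
  also have "\<dots> = emeasure lborel A * emeasure \<mu> (uminus ` B)"
    by (simp add: nn_integral_multc)
  finally show ?thesis .
qed

text \<open>The image measure is again translation invariant, so the commutation identity applies
  with the unit ball as \<open>B\<close>. That ball is symmetric and, as \<open>f\<close> preserves
  norms, has the same mass under both measures; this mass is positive and finite, hence
  cancels.\<close>

lemma lborel_distr_orthogonal_transformation:
  fixes f :: "'a::euclidean_space \<Rightarrow> 'a"
  assumes f: "orthogonal_transformation f"
  shows "distr lborel borel f = lborel"
proof (rule measure_eqI)
  let ?\<mu> = "distr lborel borel f"
  have lin: "linear f" and inj: "inj f"
    using f by (auto intro: orthogonal_transformation_linear orthogonal_transformation_inj)
  have [measurable]: "f \<in> borel \<rightarrow>\<^sub>M borel"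
    using lin by (intro borel_measurable_continuous_onI linear_continuous_on linear_conv_bounded_linear[THEN iffD1])
  have vball: "f -` ball 0 r = ball 0 r" for r
    using f by (auto simp: orthogonal_transformation_norm)
  have \<mu>_ball: "emeasure ?\<mu> (ball 0 r) = emeasure lborel (ball (0::'a) r)" for r
    by (simp add: emeasure_distr vball)
  have sf: "sigma_finite_measure ?\<mu>"
  proof
    have "(\<Union>n. ball (0::'a) (real n)) = UNIV"
      using reals_Archimedean2 by auto
    then show "\<exists>A. countable A \<and> A \<subseteq> sets ?\<mu> \<and> \<Union>A = space ?\<mu> \<and> (\<forall>a\<in>A. emeasure ?\<mu> a \<noteq> \<infinity>)"
      using emeasure_lborel_ball_finite[of "0::'a", THEN less_imp_neq]
      by (intro exI[of _ "range (\<lambda>n. ball 0 (real n))"]) (auto simp: \<mu>_ball)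
  qed
  fix A assume "A \<in> sets ?\<mu>"
  then have A: "A \<in> sets borel" by simp
  have uball: "uminus ` ball (0::'a) 1 = ball 0 1"
    by (force simp: image_iff intro: bexI[of _ "- _"])
  have pos: "emeasure lborel (ball (0::'a) 1) \<noteq> 0"
    using content_ball_pos[of 1 "0::'a"] by (auto simp: measure_def)
  have fin: "emeasure lborel (ball (0::'a) 1) \<noteq> \<infinity>"
    using emeasure_bounded_finite[OF bounded_ball, of "0::'a" 1] by (simp add: less_top)
  have "emeasure ?\<mu> A * emeasure lborel (ball (0::'a) 1) = emeasure lborel A * emeasure ?\<mu> (uminus ` ball 0 1)"
    by (rule emeasure_translation_invariant_commute[OF sf _ _ A])
       (auto intro: distr_translation_lborel_orthogonal[OF f])
  then have "emeasure lborel (ball (0::'a) 1) * emeasure ?\<mu> A = emeasure lborel (ball (0::'a) 1) * emeasure lborel A"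
    by (simp add: uball \<mu>_ball mult.commute)
  then show "emeasure ?\<mu> A = emeasure lborel A"
    using pos fin by (simp add: ennreal_mult_cancel_left)
qed simp

section \<open>Spectral form of matrices\<close>

definition diag_mat :: "('n \<Rightarrow> real) \<Rightarrow> real ^ 'n ^ 'n" where
  "diag_mat d = (\<chi> i j. if i = j then d i else 0)"

text \<open>Eigenvectors \<open>Q\<close> and eigenvalues \<open>d\<close> are kept as separate
  arguments: for orthogonal \<open>Q\<close>, products, inverses, roots and determinants become
  operations on \<open>d\<close> alone.\<close>

definition spectral_mat :: "real ^ 'n ^ 'n \<Rightarrow> ('n \<Rightarrow> real) \<Rightarrow> real ^ 'n ^ 'n" where
  "spectral_mat Q d = Q ** diag_mat d ** transpose Q"

lemma diag_mat_mult_vec: "diag_mat d *v x = (\<chi> i. d i * x $ i)"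
  by (simp add: diag_mat_def matrix_vector_mult_def vec_eq_iff if_distrib[of "\<lambda>a. a * _"] cong: if_cong)

lemma spectral_mat_mult_vec: "spectral_mat Q d *v x = Q *v (\<chi> i. d i * (x v* Q) $ i)"
  by (simp add: spectral_mat_def matrix_vector_mul_assoc[symmetric] diag_mat_mult_vec)

text \<open>\<open>x v* Q\<close> is the simplifier's normal form of
  \<open>transpose Q *v x\<close>; reversing that rewrite exposes the products of \<open>Q\<close>
  with its transpose.\<close>

lemma orthogonal_matrix_cancel:
  fixes Q :: "real ^ 'n ^ 'n"
  assumes "orthogonal_matrix Q"
  shows "(Q *v x) v* Q = x" "Q *v (x v* Q) = x"
  using assms
  by (simp_all add: matrix_vector_mul_assoc orthogonal_matrix_def
      del: transpose_matrix_vector flip: transpose_matrix_vector)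

lemma inner_orthogonal_matrix:
  fixes Q :: "real ^ 'n ^ 'n"
  assumes "orthogonal_matrix Q"
  shows "(Q *v x) \<bullet> (Q *v y) = x \<bullet> y"
  by (metis assms dot_lmul_matrix inner_commute orthogonal_matrix_cancel(1) transpose_matrix_vector)

lemma norm_orthogonal_matrix:
  fixes Q :: "real ^ 'n ^ 'n"
  assumes "orthogonal_matrix Q"
  shows "norm (Q *v x) = norm x"
  by (simp add: norm_eq_sqrt_inner inner_orthogonal_matrix[OF assms])

lemma spectral_mat_mult:
  assumes "orthogonal_matrix Q"
  shows "spectral_mat Q a ** spectral_mat Q b = spectral_mat Q (\<lambda>i. a i * b i)"
  by (simp add: matrix_eq spectral_mat_mult_vec orthogonal_matrix_cancel[OF assms] mult.assoc
        flip: matrix_vector_mul_assoc)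

lemma spectral_mat_one:
  assumes "orthogonal_matrix Q"
  shows "spectral_mat Q (\<lambda>_. 1) = mat 1"
  by (simp add: matrix_eq spectral_mat_mult_vec orthogonal_matrix_cancel[OF assms])

text \<open>\<open>matrix_inv\<close> is a choice; \<open>B\<close> witnesses that the chosen matrix
  is a two-sided inverse, and associativity then identifies it with \<open>B\<close>.\<close>

lemma matrix_inv_unique:
  fixes A :: "real ^ 'n ^ 'n"
  assumes "A ** B = mat 1" "B ** A = mat 1"
  shows "matrix_inv A = B"
proof -
  have inv: "A ** matrix_inv A = mat 1 \<and> matrix_inv A ** A = mat 1"
    unfolding matrix_inv_def by (rule someI[of _ B]) (simp add: assms)
  have "matrix_inv A = (B ** A) ** matrix_inv A"
    by (simp add: assms)
  also have "\<dots> = B"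
    by (simp only: inv matrix_mul_rid flip: matrix_mul_assoc)
  finally show ?thesis .
qed

lemma matrix_inv_spectral_mat:
  assumes "orthogonal_matrix Q" and "\<And>i. d i \<noteq> 0"
  shows "matrix_inv (spectral_mat Q d) = spectral_mat Q (\<lambda>i. 1 / d i)"
  using assms by (intro matrix_inv_unique) (simp_all add: spectral_mat_mult spectral_mat_one)

lemma det_spectral_mat:
  assumes "orthogonal_matrix Q"
  shows "det (spectral_mat Q d) = (\<Prod>i\<in>UNIV. d i)"
proof -
  have "det Q * det Q = 1"
    using det_orthogonal_matrix[OF assms] by auto
  moreover have "det (diag_mat d) = (\<Prod>i\<in>UNIV. d i)"
    by (subst det_diagonal) (auto simp: diag_mat_def)
  ultimately show ?thesis
    by (simp add: spectral_mat_def det_mul det_transpose)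
qed

text \<open>Eigenbasis coordinates diagonalise the quadratic form. This serves both the positivity
  criterion and the exponent of the Gaussian density.\<close>

lemma inner_spectral_mat:
  assumes "orthogonal_matrix Q"
  shows "(Q *v x) \<bullet> (spectral_mat Q d *v (Q *v x)) = (\<Sum>i\<in>UNIV. d i * (x $ i)\<^sup>2)"
  unfolding spectral_mat_mult_vec orthogonal_matrix_cancel[OF assms] inner_orthogonal_matrix[OF assms]
  by (simp add: inner_vec_def power2_eq_square mult_ac)

text \<open>Testing the form on the eigenvector \<open>Q *v axis i 1\<close> isolates
  \<open>d i\<close>; conversely, one nonzero eigenbasis coordinate already makes the diagonalised
  form positive.\<close>

lemma sym_pos_def_spectral_mat:
  assumes Q: "orthogonal_matrix Q"
  shows "sym_pos_def (spectral_mat Q d) \<longleftrightarrow> (\<forall>i. d i > 0)"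
proof
  assume pd: "sym_pos_def (spectral_mat Q d)"
  show "\<forall>i. d i > 0"
  proof
    fix i
    have "Q *v axis i 1 \<noteq> 0"
      using norm_orthogonal_matrix[OF Q, of "axis i 1"] by force
    then have "0 < (Q *v axis i 1) \<bullet> (spectral_mat Q d *v (Q *v axis i 1))"
      using pd by (simp add: sym_pos_def_def)
    also have "\<dots> = d i"
      unfolding inner_spectral_mat[OF Q]
      by (simp add: axis_def if_distrib[of "\<lambda>a. _ * a\<^sup>2"] cong: if_cong)
    finally show "d i > 0" .
  qed
next
  assume pos: "\<forall>i. d i > 0"
  have "transpose (diag_mat d) = diag_mat d"
    by (auto simp: diag_mat_def transpose_def vec_eq_iff)
  then have "transpose (spectral_mat Q d) = spectral_mat Q d"
    by (simp add: spectral_mat_def matrix_transpose_mul matrix_mul_assoc)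
  moreover have "x \<bullet> (spectral_mat Q d *v x) > 0" if "x \<noteq> 0" for x
  proof -
    define y where "y = x v* Q"
    have x: "x = Q *v y"
      by (simp add: y_def orthogonal_matrix_cancel[OF Q])
    then have "y \<noteq> 0"
      using that by auto
    then obtain i where "y $ i \<noteq> 0"
      by (auto simp: vec_eq_iff)
    then have "0 < (\<Sum>i\<in>UNIV. d i * (y $ i)\<^sup>2)"
      using pos by (intro sum_pos2[of _ i]) (auto simp: less_imp_le)
    then show ?thesis
      unfolding x inner_spectral_mat[OF Q] .
  qed
  ultimately show "sym_pos_def (spectral_mat Q d)"
    by (simp add: sym_pos_def_def)
qed

section \<open>Uniqueness of the positive definite square root\<close>

text \<open>The rows of a symmetric \<open>D\<close> are its columns, so each diagonal entry of
  \<open>D ** R ** D\<close> is the quadratic form of \<open>R\<close> at a column of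
  \<open>D\<close>.\<close>

lemma trace_conj_symmetric:
  fixes R D :: "real ^ 'n ^ 'n"
  assumes "transpose D = D"
  shows "trace (D ** R ** D) = (\<Sum>j\<in>UNIV. column j D \<bullet> (R *v column j D))"
proof -
  have sym: "D $ j $ k = column j D $ k" for j k
    by (subst assms[symmetric]) (simp add: transpose_def column_def)
  have "(D ** R ** D) $ j $ j = column j D \<bullet> (R *v column j D)" for j
  proof -
    have "(D ** R ** D) $ j $ j = (\<Sum>k\<in>UNIV. D $ j $ k * (R ** D) $ k $ j)"
      by (subst matrix_mul_assoc[symmetric], subst matrix_matrix_mult_def) simp
    also have "\<dots> = (\<Sum>k\<in>UNIV. column j D $ k * (R *v column j D) $ k)"
      by (simp only: sym) (simp add: matrix_matrix_mult_def matrix_vector_mult_def column_def)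
    finally show ?thesis
      by (simp add: inner_vec_def)
  qed
  then show ?thesis
    by (simp add: trace_def)
qed

text \<open>With \<open>D = R - S\<close> one has \<open>R D + D S = 0\<close>, so the traces of \<open>D R D\<close> and \<open>D S D\<close> add up to
  zero, while both are sums of nonnegative quadratic forms in the columns of \<open>D\<close>.\<close>

lemma spd_root_unique:
  fixes R S :: "real ^ 'n ^ 'n"
  assumes R: "sym_pos_def R" and S: "sym_pos_def S" and eq: "R ** R = S ** S"
  shows "R = S"
proof -
  define D where "D = R - S"
  have sym: "transpose D = D"
    using R S by (simp add: D_def sym_pos_def_def transpose_def vec_eq_iff)
  \<comment> \<open>The mixed terms \<open>R ** S\<close> cancel, leaving the difference of the two
    squares.\<close>
  have "R ** D + D ** S = 0"
    using eq by (simp add: matrix_eq D_def algebra_simps flip: matrix_vector_mul_assoc)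
  \<comment> \<open>Cyclicity of the trace brings \<open>D\<close> to the front in the second
    summand, so that \<open>D\<close> factors out on the left.\<close>
  have "trace (D ** R ** D) + trace (D ** S ** D) = trace (D ** R ** D) + trace (D ** (D ** S))"
    by (metis trace_mul_sym matrix_mul_assoc)
  also have "\<dots> = trace (D ** (R ** D + D ** S))"
    by (simp add: trace_add[symmetric] matrix_add_ldistrib matrix_mul_assoc)
  also have "\<dots> = 0"
    by (simp add: \<open>R ** D + D ** S = 0\<close> trace_def)
  finally have zero: "(\<Sum>j\<in>UNIV. column j D \<bullet> (R *v column j D) + column j D \<bullet> (S *v column j D)) = 0"
    by (simp add: trace_conj_symmetric[OF sym] sum.distrib)
  have nonneg: "0 \<le> x \<bullet> (R *v x)" "0 \<le> x \<bullet> (S *v x)" for x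
    using R S by (cases "x = 0"; force simp: sym_pos_def_def less_imp_le)+
  have "column j D = 0" for j
  proof (rule ccontr)
    assume "column j D \<noteq> 0"
    then have "column j D \<bullet> (R *v column j D) > 0"
      using R by (simp add: sym_pos_def_def)
    moreover have "column j D \<bullet> (R *v column j D) + column j D \<bullet> (S *v column j D) = 0"
      using zero by (subst (asm) sum_nonneg_eq_0_iff) (auto simp: nonneg)
    ultimately show False
      using nonneg(2)[of "column j D"] by linarith
  qed
  then have "D = 0"
    by (simp add: vec_eq_iff column_def)
  then show ?thesis
    by (simp add: D_def)
qed

text \<open>Taking roots of the eigenvalues yields one positive definite root, and by uniqueness it
  is the one that \<open>THE\<close> denotes.\<close>

lemma spd_sqrt_spectral_mat:
  assumes Q: "orthogonal_matrix Q" and d: "\<And>i. d i > 0"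
  shows "spd_sqrt (spectral_mat Q d) = spectral_mat Q (\<lambda>i. sqrt (d i))"
  unfolding spd_sqrt_def
proof (rule the_equality)
  show root: "sym_pos_def (spectral_mat Q (\<lambda>i. sqrt (d i))) \<and>
      spectral_mat Q (\<lambda>i. sqrt (d i)) ** spectral_mat Q (\<lambda>i. sqrt (d i)) = spectral_mat Q d"
    using d by (simp add: sym_pos_def_spectral_mat[OF Q] spectral_mat_mult[OF Q] less_imp_le)
  fix R assume R: "sym_pos_def R \<and> R ** R = spectral_mat Q d"
  show "R = spectral_mat Q (\<lambda>i. sqrt (d i))"
    using R root by (simp add: spd_root_unique)
qed

section \<open>Product measures\<close>

text \<open>The preimage of a box under a coordinatewise map is a box, and boxes determine the
  product measure.\<close>

lemma PiM_distr:
  assumes I: "finite I" and M: "\<And>i. prob_space (M i)"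
    and f [measurable]: "\<And>i. f i \<in> M i \<rightarrow>\<^sub>M N i"
  shows "(\<Pi>\<^sub>M i\<in>I. distr (M i) (N i) (f i)) = distr (Pi\<^sub>M I M) (Pi\<^sub>M I N) (\<lambda>x. \<lambda>i\<in>I. f i (x i))"
proof -
  interpret M: product_prob_space M I
    by (rule product_prob_spaceI) (rule M)
  interpret D: product_prob_space "\<lambda>i. distr (M i) (N i) (f i)" I
    by (rule product_prob_spaceI) (auto intro!: prob_space.prob_space_distr M)
  show ?thesis
  proof (rule D.PiM_eqI[OF I, symmetric])
    show "sets (distr (Pi\<^sub>M I M) (Pi\<^sub>M I N) (\<lambda>x. \<lambda>i\<in>I. f i (x i)))
        = sets (\<Pi>\<^sub>M i\<in>I. distr (M i) (N i) (f i))"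
      by (auto intro!: sets_PiM_cong)
    fix A assume "\<And>i. i \<in> I \<Longrightarrow> A i \<in> sets (distr (M i) (N i) (f i))"
    then have A [measurable]: "\<And>i. i \<in> I \<Longrightarrow> A i \<in> sets (N i)"
      by simp
    have "(\<lambda>x. \<lambda>i\<in>I. f i (x i)) -` Pi\<^sub>E I A \<inter> space (Pi\<^sub>M I M)
        = Pi\<^sub>E I (\<lambda>i. f i -` A i \<inter> space (M i))"
      by (auto simp: space_PiM PiE_iff)
    then show "emeasure (distr (Pi\<^sub>M I M) (Pi\<^sub>M I N) (\<lambda>x. \<lambda>i\<in>I. f i (x i))) (Pi\<^sub>E I A)
        = (\<Prod>i\<in>I. emeasure (distr (M i) (N i) (f i)) (A i))"
      using I by (simp add: emeasure_distr M.emeasure_PiM measurable_sets[OF f A] sets_PiM_I_finite)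
  qed
qed

text \<open>On a box the integrand factors over the coordinates, so the integral is a product of
  one-dimensional ones. Sigma-finiteness of the densities lets the values on boxes determine their
  product.\<close>

lemma PiM_density:
  fixes M :: "'i \<Rightarrow> 'a measure" and f :: "'i \<Rightarrow> 'a \<Rightarrow> ennreal"
  assumes I: "finite I" and M: "\<And>i. sigma_finite_measure (M i)"
    and f [measurable]: "\<And>i. f i \<in> borel_measurable (M i)"
    and D: "\<And>i. sigma_finite_measure (density (M i) (f i))"
  shows "(\<Pi>\<^sub>M i\<in>I. density (M i) (f i)) = density (Pi\<^sub>M I M) (\<lambda>x. \<Prod>i\<in>I. f i (x i))"
proof -
  interpret M: product_sigma_finite M
    by (rule product_sigma_finite.intro) (rule M)
  interpret D: product_sigma_finite "\<lambda>i. density (M i) (f i)"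
    by (rule product_sigma_finite.intro) (rule D)
  show ?thesis
  proof (rule D.PiM_eqI[OF I, symmetric])
    show "sets (density (Pi\<^sub>M I M) (\<lambda>x. \<Prod>i\<in>I. f i (x i))) = sets (\<Pi>\<^sub>M i\<in>I. density (M i) (f i))"
      by (auto intro!: sets_PiM_cong)
    fix A assume "\<And>i. i \<in> I \<Longrightarrow> A i \<in> sets (density (M i) (f i))"
    then have A [measurable]: "\<And>i. i \<in> I \<Longrightarrow> A i \<in> sets (M i)"
      by simp
    have "emeasure (density (Pi\<^sub>M I M) (\<lambda>x. \<Prod>i\<in>I. f i (x i))) (Pi\<^sub>E I A)
        = (\<integral>\<^sup>+x. (\<Prod>i\<in>I. f i (x i)) * indicator (Pi\<^sub>E I A) x \<partial>Pi\<^sub>M I M)"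
      using I by (intro emeasure_density) (auto intro: sets_PiM_I_finite)
    also have "\<dots> = (\<integral>\<^sup>+x. (\<Prod>i\<in>I. f i (x i) * indicator (A i) (x i)) \<partial>Pi\<^sub>M I M)"
    proof (intro nn_integral_cong)
      fix x assume "x \<in> space (Pi\<^sub>M I M)"
      then have "indicator (Pi\<^sub>E I A) x = (\<Prod>i\<in>I. indicator (A i) (x i) :: ennreal)"
        using I by (auto simp: indicator_def space_PiM PiE_iff prod_zero_iff)
      then show "(\<Prod>i\<in>I. f i (x i)) * indicator (Pi\<^sub>E I A) x
          = (\<Prod>i\<in>I. f i (x i) * indicator (A i) (x i))"
        by (simp add: prod.distrib)
    qed
    also have "\<dots> = (\<Prod>i\<in>I. \<integral>\<^sup>+x. f i x * indicator (A i) x \<partial>M i)"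
      using I by (intro M.product_nn_integral_prod) auto
    also have "\<dots> = (\<Prod>i\<in>I. emeasure (density (M i) (f i)) (A i))"
      by (intro prod.cong) (auto simp: emeasure_density)
    finally show "emeasure (density (Pi\<^sub>M I M) (\<lambda>x. \<Prod>i\<in>I. f i (x i))) (Pi\<^sub>E I A)
        = (\<Prod>i\<in>I. emeasure (density (M i) (f i)) (A i))" .
  qed
qed

section \<open>Lebesgue measure on \<open>real ^ 'n\<close> as a product\<close>

lemma borel_measurable_vec_lambda [measurable]:
  "(\<lambda>x. \<chi> i. x i) \<in> borel_measurable (\<Pi>\<^sub>M i\<in>UNIV. borel :: real measure)"
proof (rule borel_measurable_euclidean_space[THEN iffD2], intro ballI)
  fix b :: "real ^ 'n" assume "b \<in> Basis"
  then obtain j where "b = axis j 1"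
    by (auto simp: Basis_vec_def)
  then show "(\<lambda>x. (\<chi> i. x i) \<bullet> b) \<in> borel_measurable (\<Pi>\<^sub>M i\<in>UNIV. borel :: real measure)"
    by (simp add: inner_axis)
qed

text \<open>Lebesgue measure is determined by the volumes of boxes, and an open box pulls back to a
  product of open intervals. Product densities can thereby be carried over to vectors.\<close>

lemma lborel_vec_eq: "(lborel :: (real ^ 'n) measure) = distr (\<Pi>\<^sub>M i\<in>UNIV. lborel) borel (\<lambda>x. \<chi> i. x i)"
proof (rule lborel_eqI)
  interpret product_sigma_finite "\<lambda>_::'n. lborel :: real measure"
    by standard
  fix l u :: "real ^ 'n"
  assume le: "\<And>b. b \<in> Basis \<Longrightarrow> l \<bullet> b \<le> u \<bullet> b"
  have le': "l $ i \<le> u $ i" for i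
    using le[of "axis i 1"] by (simp add: inner_axis)
  have [measurable]: "(\<lambda>x. \<chi> i. x i) \<in> borel_measurable (\<Pi>\<^sub>M i\<in>UNIV. lborel :: real measure)"
    by (subst measurable_cong_sets[OF sets_PiM_cong[OF refl sets_lborel] refl])
      (rule borel_measurable_vec_lambda)
  have "(\<lambda>x. \<chi> i. x i) -` box l u \<inter> space (\<Pi>\<^sub>M i\<in>UNIV. lborel :: real measure)
      = Pi\<^sub>E UNIV (\<lambda>i. {l $ i <..< u $ i})"
    by (auto simp: box_def Basis_vec_def inner_axis space_PiM PiE_iff)
  then show "emeasure (distr (\<Pi>\<^sub>M i\<in>UNIV. lborel) borel (\<lambda>x. \<chi> i. x i)) (box l u)
      = ennreal (\<Prod>b\<in>Basis. (u - l) \<bullet> b)"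
    by (simp add: emeasure_distr emeasure_PiM le' prod_ennreal Basis_vec_def inner_axis
        prod.UNION_disjoint axis_eq_axis prod.reindex inj_on_def)
qed simp

section \<open>Gaussian vectors\<close>

abbreviation std_normal_PiM :: "('n \<Rightarrow> real) measure" where
  "std_normal_PiM \<equiv> \<Pi>\<^sub>M i\<in>UNIV. std_normal_distribution"

lemma prob_space_std_normal_distribution: "prob_space std_normal_distribution"
  using real_dist_normal_dist by (simp add: real_distribution_def)

text \<open>The product law has the product density relative to the product of one-dimensional
  Lebesgue measures; \<open>lborel_vec_eq\<close> carries this over to vectors.\<close>

lemma distr_std_normal_PiM:
  "distr std_normal_PiM borel (\<lambda>x. \<chi> i. x i)
    = density lborel (\<lambda>x::real ^ 'n. ennreal (\<Prod>i\<in>UNIV. std_normal_density (x $ i)))"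
proof -
  have sets_eq: "sets (\<Pi>\<^sub>M i\<in>UNIV. lborel :: real measure) = sets (\<Pi>\<^sub>M i\<in>(UNIV :: 'n set). borel)"
    by (intro sets_PiM_cong) auto
  have [measurable]: "(\<lambda>x. \<chi> i. x i) \<in> borel_measurable (\<Pi>\<^sub>M i\<in>(UNIV :: 'n set). lborel :: real measure)"
    by (subst measurable_cong_sets[OF sets_eq refl]) (rule borel_measurable_vec_lambda)
  have eq: "std_normal_PiM = density (\<Pi>\<^sub>M i\<in>UNIV. lborel) (\<lambda>x::'n \<Rightarrow> real. \<Prod>i\<in>UNIV. ennreal (std_normal_density (x i)))"
    by (intro PiM_density)
       (auto intro: sigma_finite_lborel prob_space_imp_sigma_finite prob_space_std_normal_distribution)
  have "density lborel (\<lambda>x::real ^ 'n. ennreal (\<Prod>i\<in>UNIV. std_normal_density (x $ i)))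
      = density (distr (\<Pi>\<^sub>M i\<in>UNIV. lborel) borel (\<lambda>x. \<chi> i. x i)) (\<lambda>x::real ^ 'n. \<Prod>i\<in>UNIV. ennreal (std_normal_density (x $ i)))"
    by (simp only: lborel_vec_eq[symmetric] prod_ennreal normal_density_nonneg)
  also have "\<dots> = distr std_normal_PiM borel (\<lambda>x. \<chi> i. x i)"
    unfolding eq by (subst density_distr) simp_all
  finally show ?thesis ..
qed

lemma sqrt_prod: "sqrt (\<Prod>i\<in>A. f i) = (\<Prod>i\<in>A. sqrt (f i))"
  by (induction A rule: infinite_finite_induct) (simp_all add: real_sqrt_mult)

text \<open>The product of the \<open>sqrt (d i)\<close> is the Jacobian of the substitution; it
  cancels the root of the determinant in the normalising constant.\<close>

lemma mvn_density_spectral_mat: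
  fixes m x :: "real ^ 'n"
  assumes Q: "orthogonal_matrix Q" and d: "\<And>i. d i > 0"
  shows "(\<Prod>i\<in>UNIV. sqrt (d i)) * mvn_density m (spectral_mat Q d) (Q *v (\<chi> i. sqrt (d i) * x $ i) + m)
    = (\<Prod>i\<in>UNIV. std_normal_density (x $ i))"
proof -
  have nz: "d i \<noteq> 0" for i
    using d[of i] by simp
  have "(\<Prod>i\<in>UNIV. std_normal_density (x $ i)) = (\<Prod>i\<in>UNIV. exp (- (x $ i)\<^sup>2 / 2)) / sqrt (2 * pi) ^ CARD('n)"
    by (simp add: std_normal_density_def prod_dividef)
  also have "(\<Prod>i\<in>UNIV. exp (- (x $ i)\<^sup>2 / 2)) = exp (- (\<Sum>i\<in>UNIV. (x $ i)\<^sup>2) / 2)"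
    by (simp add: exp_sum[symmetric] sum_negf sum_divide_distrib)
  \<comment> \<open>Expanding each summand by \<open>d i / d i\<close> produces the quadratic form
    of the inverse covariance, whose eigenvalues are \<open>1 / d i\<close>.\<close>
  also have "(\<Sum>i\<in>UNIV. (x $ i)\<^sup>2) = (\<Sum>i\<in>UNIV. 1 / d i * (sqrt (d i) * x $ i)\<^sup>2)"
    using d nz by (simp add: power_mult_distrib less_imp_le)
  finally show ?thesis
    using d nz
    by (simp add: mvn_density_def matrix_inv_spectral_mat[OF Q nz] inner_spectral_mat[OF Q]
        det_spectral_mat[OF Q] real_sqrt_mult real_sqrt_power sqrt_prod prod_pos less_imp_neq power_mult_distrib)
qed

lemma borel_measurable_mvn_density [measurable]: "mvn_density m \<Sigma> \<in> borel_measurable borel"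
proof -
  have "(\<lambda>x. exp (- ((x - m) \<bullet> (matrix_inv \<Sigma> *v (x - m))) / 2)) \<in> borel_measurable borel"
    by (intro borel_measurable_continuous_onI continuous_intros
        linear_continuous_on_compose[where g = "(*v) (matrix_inv \<Sigma>)"]) auto
  then show ?thesis
    unfolding mvn_density_def[abs_def] by (rule borel_measurable_divide) simp
qed

lemma Basis_vec_eq: "(Basis :: (real ^ 'n) set) = range (\<lambda>i. axis i 1)"
  by (auto simp: Basis_vec_def)

lemma sum_Basis_vec: "(\<Sum>b\<in>Basis. f b) = (\<Sum>i\<in>UNIV. f (axis i 1 :: real ^ 'n))"
  by (simp add: Basis_vec_eq sum.reindex inj_on_def axis_eq_axis)

lemma prod_Basis_vec: "(\<Prod>b\<in>Basis. f b) = (\<Prod>i\<in>UNIV. f (axis i 1 :: real ^ 'n))"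
  by (simp add: Basis_vec_eq prod.reindex inj_on_def axis_eq_axis)

text \<open>The affine substitution is split into a coordinatewise map \<open>S\<close> followed by
  \<open>Q\<close>: \<open>S\<close> contributes the Jacobian \<open>c\<close>, while
  \<open>Q\<close> leaves Lebesgue measure unchanged.\<close>

lemma distr_gaussian:
  fixes m :: "real ^ 'n"
  assumes Q: "orthogonal_matrix Q" and d: "\<And>i. d i > 0"
  shows "density lborel (mvn_density m (spectral_mat Q d))
    = distr std_normal_PiM borel (\<lambda>x. Q *v (\<chi> i. sqrt (d i) * x i) + m)"
proof -
  define f where "f = mvn_density m (spectral_mat Q d)"
  \<comment> \<open>The shift is expressed in eigenbasis coordinates, so that applying
    \<open>Q\<close> afterwards restores \<open>m\<close>.\<close>
  define S where "S x = m v* Q + (\<chi> i. sqrt (d i) * x $ i)" for x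
  define c where "c = (\<Prod>i\<in>UNIV. sqrt (d i))"
  have [measurable]: "f \<in> borel_measurable borel"
    by (simp add: f_def)
  have Q_meas [measurable]: "(*v) Q \<in> borel \<rightarrow>\<^sub>M borel"
    by (intro borel_measurable_continuous_onI linear_continuous_on) auto
  have S_meas [measurable]: "S \<in> borel \<rightarrow>\<^sub>M borel"
    unfolding S_def[abs_def] by (intro borel_measurable_continuous_onI continuous_intros)
  have QS: "Q *v S x = Q *v (\<chi> i. sqrt (d i) * x $ i) + m" for x
    by (simp add: S_def matrix_vector_right_distrib orthogonal_matrix_cancel[OF Q])
  have S_eq: "S = (\<lambda>x. m v* Q + (\<Sum>b\<in>Basis. (((\<chi> i. sqrt (d i)) \<bullet> b) * (x \<bullet> b)) *\<^sub>R b))"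
    by (simp add: S_def sum_Basis_vec inner_axis fun_eq_iff vec_eq_iff)
       (simp add: axis_def if_distrib cong: if_cong)
  have c_eq: "c = (\<Prod>b\<in>Basis. \<bar>(\<chi> i. sqrt (d i)) \<bullet> b\<bar>)"
    using d by (simp add: c_def prod_Basis_vec inner_axis less_imp_le)
  \<comment> \<open>\<open>S\<close> multiplies volumes by \<open>c\<close>, so its image of
    Lebesgue measure has to be weighted by \<open>c\<close> to give Lebesgue measure back.\<close>
  have lborel_S: "lborel = density (distr lborel borel S) (\<lambda>_. ennreal c)"
    unfolding S_eq c_eq using d by (intro lborel_affine_euclidean) (auto simp: Basis_vec_eq inner_axis less_imp_neq[symmetric])
  have "density lborel f = density (distr lborel borel ((*v) Q)) f"
    using Q by (simp add: lborel_distr_orthogonal_transformation orthogonal_transformation_matrix)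
  also have "\<dots> = distr (density lborel (\<lambda>x. f (Q *v x))) borel ((*v) Q)"
    by (rule density_distr) auto
  also have "density lborel (\<lambda>x. f (Q *v x)) = density (density (distr lborel borel S) (\<lambda>_. ennreal c)) (\<lambda>x. f (Q *v x))"
    by (simp only: lborel_S[symmetric])
  also have "\<dots> = density (distr lborel borel S) (\<lambda>x. ennreal c * ennreal (f (Q *v x)))"
    by (rule density_density_eq) auto
  also have "\<dots> = distr (density lborel (\<lambda>x. c * f (Q *v S x))) borel S"
    using d by (subst density_distr) (auto simp: c_def ennreal_mult' prod_nonneg less_imp_le)
  also have "distr \<dots> borel ((*v) Q) = distr (density lborel (\<lambda>x. c * f (Q *v S x))) borel (\<lambda>x. Q *v S x)"
    by (subst distr_distr) (auto simp: comp_def)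
  also have "\<dots> = distr (distr std_normal_PiM borel (\<lambda>x. \<chi> i. x i)) borel (\<lambda>x. Q *v S x)"
    by (simp add: distr_std_normal_PiM QS c_def f_def mvn_density_spectral_mat[OF Q d])
  also have "\<dots> = distr std_normal_PiM borel (\<lambda>x. Q *v (\<chi> i. sqrt (d i) * x i) + m)"
    by (subst distr_distr) (simp_all add: comp_def, simp add: QS)
  finally show ?thesis
    by (simp add: f_def)
qed

text \<open>In eigenbasis coordinates the mean is absorbed as a shift by \<open>\<nu>\<close>, and
  \<open>Q\<close> drops out because it preserves norms.\<close>

lemma norm_gaussian_sqr:
  fixes m :: "real ^ 'n"
  assumes Q: "orthogonal_matrix Q" and d: "\<And>i. d i > 0"
    and \<nu>: "\<And>i. \<nu> i = (transpose Q *v (matrix_inv (spd_sqrt (spectral_mat Q d)) *v m)) $ i"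
  shows "(norm (Q *v (\<chi> i. sqrt (d i) * x i) + m))\<^sup>2 = (\<Sum>i\<in>UNIV. d i * (x i + \<nu> i)\<^sup>2)"
proof -
  have nz: "sqrt (d i) \<noteq> 0" for i
    using d[of i] by simp
  \<comment> \<open>The inverse root has eigenvalues \<open>1 / sqrt (d i)\<close> in the same
    basis, so \<open>\<nu>\<close> is the rotated mean with each coordinate divided by
    \<open>sqrt (d i)\<close>.\<close>
  have \<nu>': "sqrt (d i) * \<nu> i = (m v* Q) $ i" for i
    using nz by (simp add: \<nu> spd_sqrt_spectral_mat[OF Q d] matrix_inv_spectral_mat[OF Q nz]
        spectral_mat_mult_vec orthogonal_matrix_cancel[OF Q])
  have "Q *v (\<chi> i. sqrt (d i) * x i) + m = Q *v ((\<chi> i. sqrt (d i) * x i) + m v* Q)"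
    by (simp add: matrix_vector_right_distrib orthogonal_matrix_cancel[OF Q])
  also have "(\<chi> i. sqrt (d i) * x i) + m v* Q = (\<chi> i. sqrt (d i) * (x i + \<nu> i))"
    by (simp add: vec_eq_iff distrib_left \<nu>')
  finally show ?thesis
    using d by (simp only: norm_orthogonal_matrix[OF Q] power2_norm_eq_inner)
      (simp add: inner_vec_def less_imp_le flip: power2_eq_square add: power_mult_distrib)
qed

section \<open>Weighted sums of noncentral chi-square variables\<close>

text \<open>The definition shifts by the absolute value of \<open>\<nu>\<close>. For negative
  \<open>\<nu>\<close> the standard normal law is reflected, and squaring removes the common
  sign.\<close>

lemma noncentral_chi_square_1_sqr:
  "noncentral_chi_square_1 (\<nu>\<^sup>2) = distr std_normal_distribution borel (\<lambda>g. (g + \<nu>)\<^sup>2)"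
proof (cases "0 \<le> \<nu>")
  case False
  have "std_normal_distribution = distr std_normal_distribution borel uminus"
    by (subst (1) lborel_distr_uminus[symmetric])
       (simp add: density_distr comp_def std_normal_density_def)
  then have "noncentral_chi_square_1 (\<nu>\<^sup>2)
      = distr (distr std_normal_distribution borel uminus) borel (\<lambda>g. (g + sqrt (\<nu>\<^sup>2))\<^sup>2)"
    by (simp add: noncentral_chi_square_1_def)
  also have "\<dots> = distr std_normal_distribution borel (\<lambda>g. (g + \<nu>)\<^sup>2)"
    using False by (subst distr_distr) (auto simp: comp_def power2_eq_square algebra_simps intro!: distr_cong)
  finally show ?thesis .
qed (simp add: noncentral_chi_square_1_def)

text \<open>Independence makes the joint law of \<open>W\<close> the product of its marginals, hence
  a coordinatewise image of \<open>std_normal_PiM\<close>; the weighted sum is a further image of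
  it.\<close>

lemma distr_weighted_sum_noncentral_chi_square:
  fixes W :: "'n::finite \<Rightarrow> 'a \<Rightarrow> real"
  assumes N: "prob_space N" and indep: "prob_space.indep_vars N (\<lambda>_. borel) W UNIV"
    and W: "\<And>i. distr N borel (W i) = noncentral_chi_square_1 ((\<nu> i)\<^sup>2)"
  shows "distr N borel (\<lambda>y. \<Sum>i\<in>UNIV. \<omega> i * W i y)
    = distr std_normal_PiM borel (\<lambda>x. \<Sum>i\<in>UNIV. \<omega> i * (x i + \<nu> i)\<^sup>2)"
proof -
  interpret prob_space N by (rule N)
  have [measurable]: "W i \<in> borel_measurable N" for i
    using indep by (auto simp: indep_vars_def2)
  let ?P = "\<Pi>\<^sub>M i\<in>(UNIV::'n set). (borel :: real measure)"
  let ?h = "\<lambda>v. \<Sum>i\<in>UNIV. \<omega> i * v i"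
  have "distr N ?P (\<lambda>y. \<lambda>i\<in>UNIV. W i y) = (\<Pi>\<^sub>M i\<in>UNIV. distr N borel (W i))"
    using indep by (subst (asm) indep_vars_iff_distr_eq_PiM) auto
  also have "\<dots> = (\<Pi>\<^sub>M i\<in>UNIV. distr std_normal_distribution borel (\<lambda>g. (g + \<nu> i)\<^sup>2))"
    by (simp add: W noncentral_chi_square_1_sqr)
  also have "\<dots> = distr std_normal_PiM ?P (\<lambda>x. \<lambda>i\<in>UNIV. (x i + \<nu> i)\<^sup>2)"
    by (intro PiM_distr) (auto intro: prob_space_std_normal_distribution)
  finally have "distr (distr N ?P (\<lambda>y. \<lambda>i\<in>UNIV. W i y)) borel ?h
      = distr (distr std_normal_PiM ?P (\<lambda>x. \<lambda>i\<in>UNIV. (x i + \<nu> i)\<^sup>2)) borel ?h"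
    by simp
  then show ?thesis
    by (simp add: distr_distr comp_def)
qed

section \<open>Tail probabilities of Gaussian components and of their mixture\<close>

text \<open>Gaussian vector and weighted sum are realised on the same product of standard normals,
  where their tail events coincide.\<close>

lemma gaussian_tail_eq_cdf:
  fixes m :: "real ^ 'n" and W :: "'n \<Rightarrow> 'a \<Rightarrow> real"
  assumes Q: "orthogonal_matrix Q" and \<omega>: "\<And>i. \<omega> i > 0"
    and \<nu>: "\<And>i. \<nu> i = (transpose Q *v (matrix_inv (spd_sqrt (spectral_mat Q \<omega>)) *v m)) $ i"
    and N: "prob_space N" and indep: "prob_space.indep_vars N (\<lambda>_. borel) W UNIV"
    and W: "\<And>i. distr N borel (W i) = noncentral_chi_square_1 ((\<nu> i)\<^sup>2)"
    and r: "0 \<le> r"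
  shows "emeasure (density lborel (mvn_density m (spectral_mat Q \<omega>))) {x. r < norm x}
    = ennreal (1 - cdf (distr N borel (\<lambda>y. \<Sum>i\<in>UNIV. \<omega> i * W i y)) (r\<^sup>2))"
proof -
  let ?h = "\<lambda>x::'n \<Rightarrow> real. \<Sum>i\<in>UNIV. \<omega> i * (x i + \<nu> i)\<^sup>2"
  let ?D = "distr std_normal_PiM borel ?h"
  let ?T = "\<lambda>x. Q *v (\<chi> i. sqrt (\<omega> i) * x i) + m"
  interpret P: prob_space "std_normal_PiM :: ('n \<Rightarrow> real) measure"
    by (intro prob_space_PiM prob_space_std_normal_distribution)
  have sets_eq: "sets std_normal_PiM = sets (\<Pi>\<^sub>M i\<in>(UNIV :: 'n set). (borel :: real measure))"
    by (intro sets_PiM_cong) auto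
  have "(\<lambda>v. Q *v (\<chi> i. sqrt (\<omega> i) * v $ i) + m) \<in> borel \<rightarrow>\<^sub>M borel"
    by (intro borel_measurable_continuous_onI continuous_intros
        linear_continuous_on_compose[where g = "(*v) Q"]) auto
  from measurable_compose[OF borel_measurable_vec_lambda this]
  have T [measurable]: "?T \<in> std_normal_PiM \<rightarrow>\<^sub>M borel"
    by (simp add: measurable_cong_sets[OF sets_eq refl])
  interpret D: prob_space ?D
    by (rule P.prob_space_distr) auto
  \<comment> \<open>Squaring preserves the inequality because \<open>0 \<le> r\<close>.\<close>
  have "r < norm (?T x) \<longleftrightarrow> r\<^sup>2 < ?h x" for x
    unfolding norm_gaussian_sqr[OF Q \<omega> \<nu>, symmetric] using r by (simp add: power_mono_iff not_le[symmetric])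
  then have "?T -` {x. r < norm x} \<inter> space std_normal_PiM = ?h -` {r\<^sup>2<..} \<inter> space std_normal_PiM"
    by auto
  then have "emeasure (density lborel (mvn_density m (spectral_mat Q \<omega>))) {x. r < norm x} = emeasure ?D {r\<^sup>2<..}"
    unfolding distr_gaussian[OF Q \<omega>] by (subst (1 2) emeasure_distr) (simp_all only: T, auto)
  also have "{r\<^sup>2<..} = space ?D - {..r\<^sup>2}"
    by auto
  also have "emeasure ?D \<dots> = ennreal (1 - cdf ?D (r\<^sup>2))"
    unfolding D.emeasure_eq_measure by (subst D.prob_compl) (auto simp: cdf_def)
  finally show ?thesis
    unfolding distr_weighted_sum_noncentral_chi_square[OF N indep W] .
qed

text \<open>Linearity of the integral, once \<open>ennreal\<close> is distributed over the mixture.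
  That needs nonnegative terms, which the signs of the weights and determinants guarantee.\<close>

lemma emeasure_gaussian_mixture:
  fixes m :: "nat \<Rightarrow> real ^ 'n"
  assumes w: "\<And>l. l \<in> {1..L} \<Longrightarrow> 0 \<le> w l" and det: "\<And>l. l \<in> {1..L} \<Longrightarrow> 0 \<le> det (\<Sigma> l)"
    and A: "A \<in> sets borel"
  shows "emeasure (density lborel (gaussian_mixture_density L w m \<Sigma>)) A
    = (\<Sum>l = 1..L. ennreal (w l) * emeasure (density lborel (mvn_density (m l) (\<Sigma> l))) A)"
proof -
  have nonneg: "0 \<le> mvn_density (m l) (\<Sigma> l) x" if "l \<in> {1..L}" for l x
    using det[OF that] by (simp add: mvn_density_def)
  have eq: "ennreal (gaussian_mixture_density L w m \<Sigma> x) * indicator A x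
      = (\<Sum>l = 1..L. ennreal (w l) * (ennreal (mvn_density (m l) (\<Sigma> l) x) * indicator A x))" for x
  proof -
    have "ennreal (gaussian_mixture_density L w m \<Sigma> x)
        = (\<Sum>l = 1..L. ennreal (w l * mvn_density (m l) (\<Sigma> l) x))"
      unfolding gaussian_mixture_density_def using w nonneg by (intro sum_ennreal[symmetric]) auto
    also have "\<dots> = (\<Sum>l = 1..L. ennreal (w l) * ennreal (mvn_density (m l) (\<Sigma> l) x))"
      using w nonneg by (intro sum.cong) (auto simp: ennreal_mult)
    finally show ?thesis
      by (simp only: sum_distrib_right mult.assoc)
  qed
  have "gaussian_mixture_density L w m \<Sigma> \<in> borel_measurable borel"
    unfolding gaussian_mixture_density_def[abs_def] by measurable
  then have "emeasure (density lborel (gaussian_mixture_density L w m \<Sigma>)) A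
      = (\<integral>\<^sup>+x. (\<Sum>l = 1..L. ennreal (w l) * (ennreal (mvn_density (m l) (\<Sigma> l) x) * indicator A x)) \<partial>lborel)"
    using A by (simp add: emeasure_density eq)
  also have "\<dots> = (\<Sum>l = 1..L. ennreal (w l) * emeasure (density lborel (mvn_density (m l) (\<Sigma> l))) A)"
    using A by (subst nn_integral_sum) (auto simp: nn_integral_cmult emeasure_density)
  finally show ?thesis .
qed

section \<open>Integrity risk as a weighted sum of chi-square tails\<close>

theorem theorem1:
  fixes M :: "'a measure" and e :: "'a \<Rightarrow> real ^ 'n"
    and L :: nat and w :: "nat \<Rightarrow> real" and m :: "nat \<Rightarrow> real ^ 'n" and \<Sigma> :: "nat \<Rightarrow> real ^ 'n ^ 'n"
    and P\<^sub>T\<^sub>I\<^sub>R :: real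
    and Q \<Omega> :: "nat \<Rightarrow> real ^ 'n ^ 'n" and \<omega> \<nu> :: "nat \<Rightarrow> 'n \<Rightarrow> real"
    and N :: "nat \<Rightarrow> 'b measure" and W :: "nat \<Rightarrow> 'n \<Rightarrow> 'b \<Rightarrow> real" and Z :: "nat \<Rightarrow> 'b \<Rightarrow> real"
  assumes dim: "CARD('n) \<in> {2, 3}"
    and M: "prob_space M"
    and weights_pos: "\<And>l. l \<in> {1..L} \<Longrightarrow> w l > 0"
    and weights_sum: "(\<Sum>l = 1..L. w l) = 1"
    and spd: "\<And>l. l \<in> {1..L} \<Longrightarrow> sym_pos_def (\<Sigma> l)"
    and e: "distributed M lborel e (\<lambda>x. ennreal (gaussian_mixture_density L w m \<Sigma> x))"
    and P: "0 \<le> P\<^sub>T\<^sub>I\<^sub>R" "P\<^sub>T\<^sub>I\<^sub>R \<le> 1"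
    and orth: "\<And>l. l \<in> {1..L} \<Longrightarrow> orthogonal_matrix (Q l)"
    and diag: "\<And>l i j. l \<in> {1..L} \<Longrightarrow> i \<noteq> j \<Longrightarrow> \<Omega> l $ i $ j = 0"
    and eigendecomp: "\<And>l. l \<in> {1..L} \<Longrightarrow> \<Sigma> l = Q l ** \<Omega> l ** transpose (Q l)"
    and \<omega>: "\<And>l i. l \<in> {1..L} \<Longrightarrow> \<omega> l i = \<Omega> l $ i $ i"
    and \<nu>: "\<And>l i. l \<in> {1..L} \<Longrightarrow>
              \<nu> l i = (transpose (Q l) *v (matrix_inv (spd_sqrt (\<Sigma> l)) *v m l)) $ i"
    and N: "\<And>l. l \<in> {1..L} \<Longrightarrow> prob_space (N l)"
    and W_indep: "\<And>l. l \<in> {1..L} \<Longrightarrow> prob_space.indep_vars (N l) (\<lambda>_. borel) (W l) UNIV"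
    and W_distr: "\<And>l i. l \<in> {1..L} \<Longrightarrow>
              distr (N l) borel (W l i) = noncentral_chi_square_1 ((\<nu> l i)\<^sup>2)"
    and Z: "\<And>l y. l \<in> {1..L} \<Longrightarrow> Z l y = (\<Sum>i\<in>UNIV. \<omega> l i * W l i y)"
  shows "(\<forall>l\<in>{1..L}. \<forall>i. \<omega> l i > 0) \<and>
    feasible_radii M e P\<^sub>T\<^sub>I\<^sub>R
      = {r. 0 \<le> r \<and> (\<Sum>l = 1..L. w l * (1 - cdf (distr (N l) borel (Z l)) (r\<^sup>2))) < P\<^sub>T\<^sub>I\<^sub>R} \<and>
    protection_level M e P\<^sub>T\<^sub>I\<^sub>R
      = Inf {r. 0 \<le> r \<and> (\<Sum>l = 1..L. w l * (1 - cdf (distr (N l) borel (Z l)) (r\<^sup>2))) < P\<^sub>T\<^sub>I\<^sub>R}"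
proof -
  interpret M: prob_space M by (rule M)
  let ?tail = "\<lambda>r. \<Sum>l = 1..L. w l * (1 - cdf (distr (N l) borel (Z l)) (r\<^sup>2))"
  have \<Sigma>_eq: "\<Sigma> l = spectral_mat (Q l) (\<omega> l)" if l: "l \<in> {1..L}" for l
  proof -
    have "\<Omega> l = diag_mat (\<omega> l)"
      using diag[OF l] \<omega>[OF l] by (simp add: diag_mat_def vec_eq_iff)
    then show ?thesis
      by (simp add: eigendecomp[OF l] spectral_mat_def)
  qed
  have \<omega>_pos: "\<omega> l i > 0" if l: "l \<in> {1..L}" for l i
    using spd[OF l] by (simp add: \<Sigma>_eq[OF l] sym_pos_def_spectral_mat[OF orth[OF l]])
  have Z_eq: "Z l = (\<lambda>y. \<Sum>i\<in>UNIV. \<omega> l i * W l i y)" if "l \<in> {1..L}" for l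
    using Z[OF that] by (rule ext)
  \<comment> \<open>This makes every summand of \<open>?tail\<close> nonnegative, so that
    \<open>ennreal\<close> commutes with the sum and the final equation can be read back over the
    reals.\<close>
  have cdf_le_1: "cdf (distr (N l) borel (Z l)) x \<le> 1" if l: "l \<in> {1..L}" for l x
  proof -
    interpret N: prob_space "N l" by (rule N[OF l])
    have [measurable]: "W l i \<in> borel_measurable (N l)" for i
      using W_indep[OF l] by (auto simp: N.indep_vars_def2)
    interpret D: prob_space "distr (N l) borel (Z l)"
      by (rule N.prob_space_distr) (simp add: Z_eq[OF l])
    show ?thesis
      by (simp add: cdf_def)
  qed
  have tail: "\<P>(x in M. norm (e x) > r) = ?tail r" if r: "0 \<le> r" for r
  proof -
    have e_meas [measurable]: "e \<in> borel_measurable M"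
      using distributed_measurable[OF e] by simp
    have meas: "{x. r < norm x} \<in> sets (borel :: (real ^ 'n) measure)"
      by measurable
    have "ennreal (\<P>(x in M. norm (e x) > r)) = emeasure (distr M lborel e) {x. r < norm x}"
      by (simp add: emeasure_distr meas M.emeasure_eq_measure vimage_def Int_def conj_commute)
    also have "\<dots> = (\<Sum>l = 1..L. ennreal (w l) * emeasure (density lborel (mvn_density (m l) (\<Sigma> l))) {x. r < norm x})"
      unfolding distributed_distr_eq_density[OF e]
      using weights_pos \<omega>_pos
      by (intro emeasure_gaussian_mixture meas)
         (auto simp: \<Sigma>_eq det_spectral_mat orth intro!: prod_pos less_imp_le)
    also have "\<dots> = (\<Sum>l = 1..L. ennreal (w l * (1 - cdf (distr (N l) borel (Z l)) (r\<^sup>2))))"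
    proof (rule sum.cong[OF refl])
      fix l assume l: "l \<in> {1..L}"
      have "emeasure (density lborel (mvn_density (m l) (\<Sigma> l))) {x. r < norm x}
          = ennreal (1 - cdf (distr (N l) borel (Z l)) (r\<^sup>2))"
        unfolding \<Sigma>_eq[OF l] Z_eq[OF l]
        by (rule gaussian_tail_eq_cdf[OF orth[OF l] \<omega>_pos[OF l] _ N[OF l] W_indep[OF l] W_distr[OF l] r])
           (rule \<nu>[OF l, unfolded \<Sigma>_eq[OF l]])
      then show "ennreal (w l) * emeasure (density lborel (mvn_density (m l) (\<Sigma> l))) {x. r < norm x}
          = ennreal (w l * (1 - cdf (distr (N l) borel (Z l)) (r\<^sup>2)))"
        using weights_pos[OF l] by (simp add: ennreal_mult')
    qed
    also have "\<dots> = ennreal (?tail r)"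
      using weights_pos cdf_le_1 by (intro sum_ennreal) (simp add: less_imp_le)
    finally show ?thesis
      using weights_pos cdf_le_1 by (subst (asm) ennreal_inj) (auto intro!: sum_nonneg simp: less_imp_le)
  qed
  \<comment> \<open>The two risks are compared only for \<open>0 \<le> r\<close>, a condition that
    both sets contain.\<close>
  have "feasible_radii M e P\<^sub>T\<^sub>I\<^sub>R = {r. 0 \<le> r \<and> ?tail r < P\<^sub>T\<^sub>I\<^sub>R}"
    unfolding feasible_radii_def using tail by auto
  then show ?thesis
    using \<omega>_pos by (simp add: protection_level_def)
qed

end
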